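(* Let $\Gamma$ be a distance-regular graph with vertex set $X$ and diameter $D\ge1$, formally self-dual with respect to the ordering $\{E_i\}_{i=0}^D$ of its primitive idempotents. Let $f,\{\tau_i\}_{i=0}^D$ be nonzero complex scalars with $\tau_0=1$. Define $W=f\sum_{i=0}^D\tau_iE_i$, and for $x\in X$ define $W^*(x)=f\sum_{i=0}^D\tau_iE_i^*(x)$. Assume that for all $x\in X$ and all irreducible $T(x)$-modules $U$: (i) $U$ is thin; (ii) $U$ has the same endpoint and dual endpoint; (iii) the pair $A_1,A_1^*(x)$ acts on $U$ as a spin Leonard pair, and $W,W^*(x)$ acts on $U$ as a balanced Boltzmann pair for this spin Leonard pair; (iv) $f^{-2}=|X|^{-3/2}\sum_{i=0}^Dk_i\tau_i$. Then $W$ is a spin model.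
   Context: Distance-regular graphs. $X$ is a finite nonempty set; $\mathrm{Mat}_X(\mathbb C)$ is the algebra of complex matrices with rows and columns indexed by $X$; $I$ is the identity and $J$ the all-ones matrix; $V=\mathbb C^X$ is the space of column vectors indexed by $X$, on which $\mathrm{Mat}_X(\mathbb C)$ acts by left multiplication. $\Gamma$ is an undirected connected graph without loops or multiple edges, vertex set $X$, path-length distance $\partial$, diameter $D=\max\partial$. It is distance-regular if for all $0\le h,i,j\le D$ and all $x,y$ with $\partial(x,y)=h$ the number $p^h_{ij}=|\{z:\partial(x,z)=i,\ \partial(y,z)=j\}|$ depends only on $h,i,j$. Put $k_i=p^0_{ii}$. The distance-matrix $A_i$ has $(x,y)$-entry $1$ if $\partial(x,y)=i$ and $0$ otherwise. The Bose-Mesner algebra $M=\mathrm{Span}\{A_i\}_{i=0}^D$ is a commutative subalgebra and has a basis $\{E_i\}_{i=0}^D$ with $E_0=|X|^{-1}J$, $E_iE_j=\delta_{ij}E_i$, $\sum_iE_i=I$ (the primitive idempotents; the ordering of $E_1,\dots,E_D$ is part of the data). Define matrices $P,Q$ by $A_j=\sum_iP_{ij}E_i$, $E_j=|X|^{-1}\sum_iQ_{ij}A_i$. $\Gamma$ is formally self-dual with respect to $\{E_i\}_{i=0}^D$ if $P=Q$. For $x\in X$: $E_i^*(x)$ is the diagonal matrix with $(y,y)$-entry $1$ if $\partial(x,y)=i$ and $0$ otherwise; $A_i^*(x)$ is the diagonal matrix with $(y,y)$-entry $|X|E_i(x,y)$; $T(x)$ is the subalgebra of $\mathrm{Mat}_X(\mathbb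 C)$ generated by $M$ and all $E_i^*(x)$. A $T(x)$-module is a subspace of $V$ invariant under $T(x)$; it is irreducible if it is nonzero and has no submodules except $0$ and itself. For an irreducible $T(x)$-module $U$: the endpoint is $\min\{i:E_i^*(x)U\ne0\}$; the dual endpoint is $\min\{i:E_iU\neq0\}$; $U$ is thin if $\dim E_i^*(x)U\le1$ for all $i$. Leonard pairs. A Leonard pair on a nonzero finite-dimensional vector space $U$ is an ordered pair of linear maps $A,A^*:U\to U$ such that there is a basis of $U$ for which $A$ is irreducible tridiagonal and $A^*$ diagonal, and a basis for which $A^*$ is irreducible tridiagonal and $A$ diagonal (a tridiagonal matrix is irreducible if all its subdiagonal and superdiagonal entries are nonzero). Let $\langle A\rangle$ be the subalgebra of $\mathrm{End}(U)$ generated by $A$. A Boltzmann pair for the Leonard pair $A,A^*$ is an ordered pair $W,W^*$ with $W\in\langle A\rangle$ and $W^*\in\langle A^*\rangle$ invertible such that $WA^*W^{-1}=(W^* )^{-1}AW^*$; it is balanced if $WW^*W=W^*WW^*$. A Leonard pair is a spin Leonard pair if it has a Boltzmann pair. Spin models. $W\in\mathrm{Mat}_X(\mathbb C)$ is type II if it is symmetric with all entries nonzero and $\sum_{y\in X}W(a,y)/W(b,y)=|X|\delta_{a,b}$ for all $a,b\in X$. It is a spin model if it is type II and $\sum_{y\in X}\frac{W(a,y)W(b,y)}{W(c,y)}=|X|^{1/2}\frac{W(a,b)}{W(a,c)W(b,c)}$ for all $a,b,c\in X$ (positive square root). *)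

theory Defs
  imports "HOL-Analysis.Analysis"
begin

section \<open>Complex matrices indexed by a finite type\<close>

text \<open>
  The vertex set is the universe of a type of class \<open>finite\<close>.  Subspaces, spans and
  dimensions in the space of column vectors are the complex ones (prefix \<open>vec\<close>).  The
  library operation \<open>(*s)\<close> on a matrix would expect a vector as scalar, so complex scalar
  multiplication of matrices is introduced here.
\<close>

definition mat_scale :: "complex \<Rightarrow> complex^'n^'m \<Rightarrow> complex^'n^'m"  (infixr "*\<^sub>m" 75)
  where "c *\<^sub>m A = (\<chi> i j. c * A $ i $ j)"

global_interpretation mat_space: vector_space "mat_scale :: complex \<Rightarrow> complex^'n^'m \<Rightarrow> complex^'n^'m"
  by unfold_locales (simp_all add: mat_scale_def vec_eq_iff algebra_simps)

definition mat_subalgebra :: "(complex^'x^'x) set \<Rightarrow> bool"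
  where "mat_subalgebra S \<longleftrightarrow>
    mat_space.subspace S \<and> mat 1 \<in> S \<and> (\<forall>A\<in>S. \<forall>B\<in>S. A ** B \<in> S)"


section \<open>Distance-regular graphs\<close>

text \<open>A graph is given by its adjacency relation, a set of ordered pairs.\<close>

definition connected_graph :: "('x::finite \<times> 'x) set \<Rightarrow> bool"
  where "connected_graph R \<longleftrightarrow> sym R \<and> irrefl R \<and> (\<forall>x y. (x, y) \<in> R\<^sup>*)"

definition gdist :: "('x::finite \<times> 'x) set \<Rightarrow> 'x \<Rightarrow> 'x \<Rightarrow> nat"
  where "gdist R x y = (LEAST n. (x, y) \<in> R ^^ n)"

definition gdiam :: "('x::finite \<times> 'x) set \<Rightarrow> nat"
  where "gdiam R = Max {gdist R x y | x y. True}"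

definition distance_regular :: "('x::finite \<times> 'x) set \<Rightarrow> bool"
  where "distance_regular R \<longleftrightarrow> connected_graph R \<and>
    (\<forall>h\<le>gdiam R. \<forall>i\<le>gdiam R. \<forall>j\<le>gdiam R. \<exists>p. \<forall>x y. gdist R x y = h \<longrightarrow>
       card {z. gdist R x z = i \<and> gdist R y z = j} = p)"

definition intersection_number :: "('x::finite \<times> 'x) set \<Rightarrow> nat \<Rightarrow> nat \<Rightarrow> nat \<Rightarrow> nat"
  where "intersection_number R h i j =
    (THE p. \<forall>x y. gdist R x y = h \<longrightarrow> card {z. gdist R x z = i \<and> gdist R y z = j} = p)"

definition valency :: "('x::finite \<times> 'x) set \<Rightarrow> nat \<Rightarrow> nat"
  where "valency R i = intersection_number R 0 i i"

definition dist_mat :: "('x::finite \<times> 'x) set \<Rightarrow> nat \<Rightarrow> complex^'x^'x"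
  where "dist_mat R i = (\<chi> x y. if gdist R x y = i then 1 else 0)"

definition bose_mesner :: "('x::finite \<times> 'x) set \<Rightarrow> (complex^'x^'x) set"
  where "bose_mesner R = mat_space.span (dist_mat R ` {..gdiam R})"

text \<open>
  An ordering of the primitive idempotents is a sequence \<open>E\<close> of which only the entries with
  index at most the diameter are meaningful.
\<close>

definition primitive_idempotents :: "('x::finite \<times> 'x) set \<Rightarrow> (nat \<Rightarrow> complex^'x^'x) \<Rightarrow> bool"
  where "primitive_idempotents R E \<longleftrightarrow>
    inj_on E {..gdiam R} \<and> mat_space.independent (E ` {..gdiam R}) \<and>
    mat_space.span (E ` {..gdiam R}) = bose_mesner R \<and>
    E 0 = (1 / of_nat CARD('x)) *\<^sub>m (\<chi> x y. 1) \<and>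
    (\<forall>i\<le>gdiam R. \<forall>j\<le>gdiam R. E i ** E j = (if i = j then E i else 0)) \<and>
    (\<Sum>i\<le>gdiam R. E i) = mat 1"

definition first_eigenmatrix ::
    "('x::finite \<times> 'x) set \<Rightarrow> (nat \<Rightarrow> complex^'x^'x) \<Rightarrow> (nat \<Rightarrow> nat \<Rightarrow> complex) \<Rightarrow> bool"
  where "first_eigenmatrix R E P \<longleftrightarrow>
    (\<forall>j\<le>gdiam R. dist_mat R j = (\<Sum>i\<le>gdiam R. P i j *\<^sub>m E i))"

definition second_eigenmatrix ::
    "('x::finite \<times> 'x) set \<Rightarrow> (nat \<Rightarrow> complex^'x^'x) \<Rightarrow> (nat \<Rightarrow> nat \<Rightarrow> complex) \<Rightarrow> bool"
  where "second_eigenmatrix R E Q \<longleftrightarrow>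
    (\<forall>j\<le>gdiam R. E j = (1 / of_nat CARD('x)) *\<^sub>m (\<Sum>i\<le>gdiam R. Q i j *\<^sub>m dist_mat R i))"

text \<open>
  When \<open>E\<close> is an ordering of the primitive idempotents, the entries of \<open>P\<close> and \<open>Q\<close> with
  indices at most the diameter exist and are unique, being coordinates with respect to a basis.
\<close>

definition formally_self_dual :: "('x::finite \<times> 'x) set \<Rightarrow> (nat \<Rightarrow> complex^'x^'x) \<Rightarrow> bool"
  where "formally_self_dual R E \<longleftrightarrow>
    (\<exists>P Q. first_eigenmatrix R E P \<and> second_eigenmatrix R E Q \<and>
       (\<forall>i\<le>gdiam R. \<forall>j\<le>gdiam R. P i j = Q i j))"


section \<open>Terwilliger algebras and their modules\<close>

definition dual_idempotent :: "('x::finite \<times> 'x) set \<Rightarrow> 'x \<Rightarrow> nat \<Rightarrow> complex^'x^'x"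
  where "dual_idempotent R x i = (\<chi> y z. if y = z \<and> gdist R x y = i then 1 else 0)"

definition dual_dist_mat :: "(nat \<Rightarrow> complex^'x^'x) \<Rightarrow> 'x::finite \<Rightarrow> nat \<Rightarrow> complex^'x^'x"
  where "dual_dist_mat E x i = (\<chi> y z. if y = z then of_nat CARD('x) * E i $ x $ y else 0)"

definition terwilliger_algebra :: "('x::finite \<times> 'x) set \<Rightarrow> 'x \<Rightarrow> (complex^'x^'x) set"
  where "terwilliger_algebra R x =
    mat_subalgebra hull (bose_mesner R \<union> dual_idempotent R x ` {..gdiam R})"

definition alg_module :: "(complex^'x^'x) set \<Rightarrow> (complex^'x::finite) set \<Rightarrow> bool"
  where "alg_module T U \<longleftrightarrow> vec.subspace U \<and> (\<forall>B\<in>T. \<forall>u\<in>U. B *v u \<in> U)"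

definition irreducible_module :: "(complex^'x^'x) set \<Rightarrow> (complex^'x::finite) set \<Rightarrow> bool"
  where "irreducible_module T U \<longleftrightarrow> alg_module T U \<and> U \<noteq> {0} \<and>
    (\<forall>U'. alg_module T U' \<and> U' \<subseteq> U \<longrightarrow> U' = {0} \<or> U' = U)"

definition endpoint :: "('x::finite \<times> 'x) set \<Rightarrow> 'x \<Rightarrow> (complex^'x) set \<Rightarrow> nat"
  where "endpoint R x U = (LEAST i. i \<le> gdiam R \<and> (*v) (dual_idempotent R x i) ` U \<noteq> {0})"

definition dual_endpoint ::
    "('x::finite \<times> 'x) set \<Rightarrow> (nat \<Rightarrow> complex^'x^'x) \<Rightarrow> (complex^'x) set \<Rightarrow> nat"
  where "dual_endpoint R E U = (LEAST i. i \<le> gdiam R \<and> (*v) (E i) ` U \<noteq> {0})"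

definition thin :: "('x::finite \<times> 'x) set \<Rightarrow> 'x \<Rightarrow> (complex^'x) set \<Rightarrow> bool"
  where "thin R x U \<longleftrightarrow> (\<forall>i\<le>gdiam R. vec.dim ((*v) (dual_idempotent R x i) ` U) \<le> 1)"


section \<open>Leonard pairs\<close>

text \<open>
  The underlying vector space is a subspace \<open>U\<close> of the column vectors.  A linear map from \<open>U\<close>
  to \<open>U\<close> is a function that is \<open>undefined\<close> off \<open>U\<close>, so that equality of such
  functions is equality of maps on \<open>U\<close>.
\<close>

definition End_on :: "(complex^'n) set \<Rightarrow> (complex^'n \<Rightarrow> complex^'n) set"
  where "End_on U = {f \<in> U \<rightarrow>\<^sub>E U. (\<forall>u\<in>U. \<forall>v\<in>U. f (u + v) = f u + f v) \<and>
    (\<forall>c. \<forall>u\<in>U. f (c *s u) = c *s f u)}"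

definition End_subalgebra :: "(complex^'n) set \<Rightarrow> (complex^'n \<Rightarrow> complex^'n) set \<Rightarrow> bool"
  where "End_subalgebra U S \<longleftrightarrow> S \<subseteq> End_on U \<and> (\<lambda>u\<in>U. u) \<in> S \<and>
    (\<forall>f\<in>S. \<forall>g\<in>S. (\<lambda>u\<in>U. f u + g u) \<in> S) \<and>
    (\<forall>c. \<forall>f\<in>S. (\<lambda>u\<in>U. c *s f u) \<in> S) \<and>
    (\<forall>f\<in>S. \<forall>g\<in>S. compose U f g \<in> S)"

definition generated_by ::
    "(complex^'n) set \<Rightarrow> (complex^'n \<Rightarrow> complex^'n) \<Rightarrow> (complex^'n \<Rightarrow> complex^'n) set"
  where "generated_by U A = End_subalgebra U hull {A}"

definition basis_of :: "(complex^'n) set \<Rightarrow> nat \<Rightarrow> (nat \<Rightarrow> complex^'n) \<Rightarrow> bool"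
  where "basis_of U n v \<longleftrightarrow>
    inj_on v {..<n} \<and> vec.independent (v ` {..<n}) \<and> vec.span (v ` {..<n}) = U"

definition matrix_wrt ::
    "nat \<Rightarrow> (nat \<Rightarrow> complex^'n) \<Rightarrow> (complex^'n \<Rightarrow> complex^'n) \<Rightarrow> (nat \<Rightarrow> nat \<Rightarrow> complex) \<Rightarrow> bool"
  where "matrix_wrt n v A B \<longleftrightarrow> (\<forall>j<n. A (v j) = (\<Sum>i<n. B i j *s v i))"

definition irreducible_tridiagonal :: "nat \<Rightarrow> (nat \<Rightarrow> nat \<Rightarrow> complex) \<Rightarrow> bool"
  where "irreducible_tridiagonal n B \<longleftrightarrow> (\<forall>i<n. \<forall>j<n.
    (i > Suc j \<or> j > Suc i \<longrightarrow> B i j = 0) \<and> (i = Suc j \<or> j = Suc i \<longrightarrow> B i j \<noteq> 0))"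

definition diagonal :: "nat \<Rightarrow> (nat \<Rightarrow> nat \<Rightarrow> complex) \<Rightarrow> bool"
  where "diagonal n B \<longleftrightarrow> (\<forall>i<n. \<forall>j<n. i \<noteq> j \<longrightarrow> B i j = 0)"

definition tridiagonal_diagonal_basis ::
    "(complex^'n) set \<Rightarrow> (complex^'n \<Rightarrow> complex^'n) \<Rightarrow> (complex^'n \<Rightarrow> complex^'n) \<Rightarrow> bool"
  where "tridiagonal_diagonal_basis U A A' \<longleftrightarrow> (\<exists>n v B B'. basis_of U n v \<and>
    matrix_wrt n v A B \<and> irreducible_tridiagonal n B \<and> matrix_wrt n v A' B' \<and> diagonal n B')"

definition leonard_pair ::
    "(complex^'n) set \<Rightarrow> (complex^'n \<Rightarrow> complex^'n) \<Rightarrow> (complex^'n \<Rightarrow> complex^'n) \<Rightarrow> bool"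
  where "leonard_pair U A A' \<longleftrightarrow> vec.subspace U \<and> U \<noteq> {0} \<and> A \<in> End_on U \<and> A' \<in> End_on U \<and>
    tridiagonal_diagonal_basis U A A' \<and> tridiagonal_diagonal_basis U A' A"

definition boltzmann_pair ::
    "(complex^'n) set \<Rightarrow> (complex^'n \<Rightarrow> complex^'n) \<Rightarrow> (complex^'n \<Rightarrow> complex^'n) \<Rightarrow>
     (complex^'n \<Rightarrow> complex^'n) \<Rightarrow> (complex^'n \<Rightarrow> complex^'n) \<Rightarrow> bool"
  where "boltzmann_pair U A A' W W' \<longleftrightarrow>
    W \<in> generated_by U A \<and> W' \<in> generated_by U A' \<and> bij_betw W U U \<and> bij_betw W' U U \<and>
    compose U W (compose U A' (inv_into U W)) = compose U (inv_into U W') (compose U A W')"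

definition balanced_boltzmann_pair ::
    "(complex^'n) set \<Rightarrow> (complex^'n \<Rightarrow> complex^'n) \<Rightarrow> (complex^'n \<Rightarrow> complex^'n) \<Rightarrow>
     (complex^'n \<Rightarrow> complex^'n) \<Rightarrow> (complex^'n \<Rightarrow> complex^'n) \<Rightarrow> bool"
  where "balanced_boltzmann_pair U A A' W W' \<longleftrightarrow> boltzmann_pair U A A' W W' \<and>
    compose U W (compose U W' W) = compose U W' (compose U W W')"

definition spin_leonard_pair ::
    "(complex^'n) set \<Rightarrow> (complex^'n \<Rightarrow> complex^'n) \<Rightarrow> (complex^'n \<Rightarrow> complex^'n) \<Rightarrow> bool"
  where "spin_leonard_pair U A A' \<longleftrightarrow> leonard_pair U A A' \<and> (\<exists>W W'. boltzmann_pair U A A' W W')"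

definition action_on :: "(complex^'n) set \<Rightarrow> complex^'n^'n \<Rightarrow> complex^'n \<Rightarrow> complex^'n"
  where "action_on U B = (\<lambda>u\<in>U. B *v u)"


section \<open>Spin models\<close>

definition type_II :: "complex^'x^'x::finite \<Rightarrow> bool"
  where "type_II W \<longleftrightarrow> transpose W = W \<and> (\<forall>a b. W $ a $ b \<noteq> 0) \<and>
    (\<forall>a b. (\<Sum>y\<in>UNIV. W $ a $ y / W $ b $ y) = (if a = b then of_nat CARD('x) else 0))"

definition spin_model :: "complex^'x^'x::finite \<Rightarrow> bool"
  where "spin_model W \<longleftrightarrow> type_II W \<and>
    (\<forall>a b c. (\<Sum>y\<in>UNIV. W $ a $ y * W $ b $ y / W $ c $ y) =
       complex_of_real (sqrt (real CARD('x))) * (W $ a $ b / (W $ a $ c * W $ b $ c)))"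

end

theory Submission
  imports Defs
begin

text \<open>
  Write \<open>n\<close> for the number of vertices.  The statement reduces to one formula: the entry of
  \<open>W\<close> at a pair of vertices at distance \<open>i\<close> is \<open>sqrt n / (f \<tau>\<^sub>i)\<close>.  In other words,
  \<open>W\<^sup>*(x)\<close> carries on its diagonal \<open>sqrt n\<close> times the inverses of the entries in row \<open>x\<close> of
  \<open>W\<close>.

  The Terwilliger algebra \<open>T(x)\<close> has self-adjoint generators, so the vectors in irreducible
  \<open>T(x)\<close>-modules span the whole space (lemma \<open>span_irreducible_modules\<close>).  Therefore the two
  relations that hold on each irreducible module hold as matrix identities:
  \<open>A\<^sub>1 W\<^sup>*(x) W = W\<^sup>*(x) W A\<^sub>1\<^sup>*(x)\<close>, which is the Boltzmann relation with the inverses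
  cleared, and the balance relation \<open>W W\<^sup>*(x) W = W\<^sup>*(x) W W\<^sup>*(x)\<close>.

  For the formula, apply the first identity to the unit vector at \<open>x\<close>.  This is an eigenvector
  of \<open>A\<^sub>1\<^sup>*(x)\<close>, and by self-duality its eigenvalue \<open>Q\<^sub>0\<^sub>1 = P\<^sub>0\<^sub>1\<close> is the valency of the graph.
  Hence \<open>W\<^sup>*(x) W\<close> maps the unit vector to an eigenvector of \<open>A\<^sub>1\<close> for the valency, and in a
  connected graph such a vector is constant (lemma \<open>trivial_eigenvector_constant\<close>).  Its
  coordinate at a vertex at distance \<open>i\<close> from \<open>x\<close> is \<open>f \<tau>\<^sub>i\<close> times the entry of \<open>W\<close> at
  distance \<open>i\<close>, so this product is independent of \<open>i\<close>; the normalisation of \<open>f\<close> evaluates it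
  at \<open>i = 0\<close> as \<open>sqrt n\<close>.

  Given the formula, the type II condition says that the entrywise inverse of \<open>W\<close>, a multiple
  of \<open>\<Sum>\<^sub>i \<tau>\<^sub>i A\<^sub>i\<close>, is \<open>n\<close> times the matrix inverse of \<open>W\<close>.  Self-duality makes the coefficients
  of \<open>\<Sum>\<^sub>i \<tau>\<^sub>i A\<^sub>i\<close> in the basis \<open>E\<^sub>i\<close> proportional to the entries of \<open>W\<close>, hence to
  \<open>1 / \<tau>\<^sub>i\<close>, and this is the required inverse because the \<open>E\<^sub>i\<close> are orthogonal idempotents.  The
  remaining spin model equation is the balance relation for \<open>W\<^sup>*(c)\<close>, read at the entry
  \<open>(a, b)\<close>.
\<close>

section \<open>Matrices acting on column vectors\<close>

lemma mat_scale_vec: "(c *\<^sub>m A) *v u = c *s (A *v u)"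
  by (simp add: vec_eq_iff matrix_vector_mult_def mat_scale_def sum_distrib_left mult.assoc)

lemma mat_scale_mult_left: "(c *\<^sub>m A) ** B = c *\<^sub>m (A ** B)"
  by (simp add: vec_eq_iff matrix_matrix_mult_def mat_scale_def sum_distrib_left mult.assoc)

lemma mat_scale_mult_right: "A ** (c *\<^sub>m B) = c *\<^sub>m (A ** B)"
  by (simp add: vec_eq_iff matrix_matrix_mult_def mat_scale_def sum_distrib_left mult_ac)

lemma mat_scale_nth: "(c *\<^sub>m A) $ i $ j = c * A $ i $ j"
  by (simp add: mat_scale_def)

lemma mat_sum_mult_left: "(\<Sum>i\<in>S. A i) ** (B :: complex^'x^'x::finite) = (\<Sum>i\<in>S. A i ** B)"
  by (simp add: vec_eq_iff matrix_matrix_mult_def sum_distrib_right sum.swap[of _ _ S])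

lemma mat_sum_mult_right: "(B :: complex^'x^'x::finite) ** (\<Sum>i\<in>S. A i) = (\<Sum>i\<in>S. B ** A i)"
  by (simp add: vec_eq_iff matrix_matrix_mult_def sum_distrib_left sum.swap[of _ _ S])

lemma subspace_of_preserving_matrices:
  assumes "vec.subspace U"
  shows "mat_space.subspace {B :: complex^'x^'x::finite. \<forall>u\<in>U. B *v u \<in> U}"
  using assms unfolding mat_space.subspace_def vec.subspace_def
  by (auto simp: matrix_vector_mult_add_rdistrib mat_scale_vec matrix_vector_mult_0)

lemma complex_subspace_imp_subspace:
  fixes U :: "(complex^'x::finite) set"
  assumes "vec.subspace U"
  shows "subspace U"
proof -
  have "c *\<^sub>R u = complex_of_real c *s u" for c and u :: "complex^'x"
    by (simp only: vec_eq_iff vector_scaleR_component vector_smult_component)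
      (simp add: scaleR_conv_of_real)
  then show ?thesis
    using assms by (simp add: subspace_def vec.subspace_def)
qed

lemma inner_scale_left_complex:
  "(c *s u) \<bullet> v = u \<bullet> (cnj c *s (v :: complex^'x::finite))"
  by (simp add: inner_vec_def inner_complex_def algebra_simps)

lemma inner_real_symmetric:
  fixes B :: "complex^'x^'x::finite"
  assumes "\<And>i j. B $ i $ j = B $ j $ i" "\<And>i j. Im (B $ i $ j) = 0"
  shows "(B *v u) \<bullet> v = u \<bullet> (B *v v)"
proof -
  have entry_left: "(B $ i $ j * c) \<bullet> d = Re (B $ i $ j) * (c \<bullet> d)"
    and entry_right: "c \<bullet> (B $ i $ j * d) = Re (B $ i $ j) * (c \<bullet> d)" for i j c d
    by (simp_all add: inner_complex_def assms(2) algebra_simps)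
  have "(B *v u) \<bullet> v = (\<Sum>i\<in>UNIV. \<Sum>j\<in>UNIV. Re (B $ i $ j) * (u $ j \<bullet> v $ i))"
    by (simp add: inner_vec_def matrix_vector_mult_def inner_sum_left entry_left)
  also have "\<dots> = (\<Sum>i\<in>UNIV. \<Sum>j\<in>UNIV. Re (B $ j $ i) * (u $ i \<bullet> v $ j))"
    by (rule sum.swap)
  also have "\<dots> = (\<Sum>i\<in>UNIV. \<Sum>j\<in>UNIV. Re (B $ i $ j) * (u $ i \<bullet> v $ j))"
    using assms(1) by simp
  also have "\<dots> = u \<bullet> (B *v v)"
    by (simp add: inner_vec_def matrix_vector_mult_def inner_sum_right entry_right)
  finally show ?thesis .
qed

lemma matrix_vector_mult_axis:
  fixes A :: "'a::semiring_1^'n^'m"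
  shows "(A *v axis k 1) $ i = A $ i $ k"
  by (simp add: matrix_vector_mult_def axis_def if_distrib[of "\<lambda>c. _ * c"] cong: if_cong)


section \<open>Distances in a connected graph\<close>

lemma gdist_relpow:
  assumes "connected_graph R"
  shows "(x, y) \<in> R ^^ gdist R x y"
proof -
  have "\<exists>n. (x, y) \<in> R ^^ n"
    using assms by (auto simp: connected_graph_def rtrancl_is_UN_relpow)
  then show ?thesis
    unfolding gdist_def by (rule LeastI_ex)
qed

lemma gdist_le: "(x, y) \<in> R ^^ n \<Longrightarrow> gdist R x y \<le> n"
  unfolding gdist_def by (rule Least_le)

lemma gdist_commute:
  assumes "connected_graph R"
  shows "gdist R x y = gdist R y x"
proof -
  have "(a, b) \<in> R ^^ n \<Longrightarrow> (b, a) \<in> R ^^ n" for a b n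
  proof (induction n arbitrary: b)
    case (Suc n)
    then obtain c where "(a, c) \<in> R ^^ n" "(c, b) \<in> R" by auto
    then have "(b, c) \<in> R" "(c, a) \<in> R ^^ n"
      using Suc.IH assms by (auto simp: connected_graph_def sym_def)
    then show ?case by (meson relpow_Suc_I2)
  qed auto
  then show ?thesis
    using gdist_relpow[OF assms] gdist_le by (metis le_antisym)
qed

lemma gdist_refl [simp]: "gdist R x x = 0"
  using gdist_le[of x x 0 R] by simp

lemma gdist_eq_1_iff:
  assumes "connected_graph R"
  shows "gdist R x y = 1 \<longleftrightarrow> (x, y) \<in> R"
proof
  assume "gdist R x y = 1"
  then show "(x, y) \<in> R"
    using gdist_relpow[OF assms, of x y] by simp
next
  assume xy: "(x, y) \<in> R"
  then have "x \<noteq> y" using assms by (auto simp: connected_graph_def irrefl_def)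
  then have "(x, y) \<notin> R ^^ 0" by simp
  then have "gdist R x y \<noteq> 0"
    using gdist_relpow[OF assms, of x y] by (intro notI) (simp only:)
  moreover have "gdist R x y \<le> 1" using xy gdist_le[of x y 1 R] by simp
  ultimately show "gdist R x y = 1" by linarith
qed

lemma finite_gdist_values: "finite {gdist R x y | x y. True}"
proof -
  have "{gdist R x y | x y. True} = (\<lambda>(x, y). gdist R x y) ` UNIV" by auto
  then show ?thesis by simp
qed

lemma gdist_le_gdiam: "gdist R x y \<le> gdiam R"
  unfolding gdiam_def by (rule Max_ge[OF finite_gdist_values]) auto

text \<open>Every initial part of a geodesic is a geodesic, so no distance below the diameter is skipped.\<close>

lemma gdist_attained:
  assumes "connected_graph R" "i \<le> gdiam R"
  shows "\<exists>x y. gdist R x y = i"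
  using assms(2)
proof (induction i rule: inc_induct)
  case base
  have "gdiam R \<in> {gdist R x y | x y. True}"
    unfolding gdiam_def by (rule Max_in[OF finite_gdist_values]) auto
  then show ?case by (auto dest: sym)
next
  case (step n)
  then obtain x y where xy: "gdist R x y = Suc n" by blast
  then obtain z where z: "(x, z) \<in> R ^^ n" "(z, y) \<in> R"
    using gdist_relpow[OF assms(1), of x y] by auto
  have "(x, y) \<in> R ^^ Suc (gdist R x z)"
    using gdist_relpow[OF assms(1), of x z] z(2) by auto
  then have "Suc n \<le> Suc (gdist R x z)"
    using xy gdist_le by metis
  moreover have "gdist R x z \<le> n" by (rule gdist_le[OF z(1)])
  ultimately show ?case by (intro exI[of _ x] exI[of _ z]) simp
qed

text \<open>
  The maximum principle: where a harmonic function attains its maximum, all neighbours attain it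
  too.
\<close>

lemma harmonic_constant_real:
  fixes u :: "'x::finite \<Rightarrow> real"
  assumes "connected_graph R" "\<And>y. (\<Sum>z\<in>R `` {y}. u z - u y) = 0"
  shows "u a = u b"
proof -
  have "Max (range u) \<in> range u" by (rule Max_in) auto
  then obtain m where "Max (range u) = u m" by (rule imageE)
  then have m: "u y \<le> u m" for y by (metis Max_ge finite finite_imageI rangeI)
  have "u y = u m" if "(m, y) \<in> R\<^sup>*" for y
    using that
  proof (induction rule: rtrancl_induct)
    case (step y z)
    have "(\<Sum>z\<in>R `` {y}. u y - u z) = 0"
      using assms(2)[of y] by (simp add: sum_subtractf)
    then have "\<forall>z\<in>R `` {y}. u y - u z = 0"
      using m step.IH by (subst (asm) sum_nonneg_eq_0_iff) auto
    then show ?case using step by auto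
  qed auto
  then have "u y = u m" for y using assms(1) by (simp add: connected_graph_def)
  then show ?thesis by metis
qed

lemma harmonic_constant:
  fixes u :: "'x::finite \<Rightarrow> complex"
  assumes "connected_graph R" "\<And>y. (\<Sum>z\<in>R `` {y}. u z - u y) = 0"
  shows "u a = u b"
proof (rule complex_eqI)
  have "(\<Sum>z\<in>R `` {y}. Re (u z) - Re (u y)) = 0" for y
    using arg_cong[OF assms(2)[of y], of Re] by simp
  then show "Re (u a) = Re (u b)" by (rule harmonic_constant_real[OF assms(1)])
  have "(\<Sum>z\<in>R `` {y}. Im (u z) - Im (u y)) = 0" for y
    using arg_cong[OF assms(2)[of y], of Im] by simp
  then show "Im (u a) = Im (u b)" by (rule harmonic_constant_real[OF assms(1)])
qed

text \<open>
  The trivial eigenvalue of the adjacency matrix has only the constant vectors as eigenvectors: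
  it is the common valency, so the eigenvector equation says that the vector is harmonic.
\<close>

lemma trivial_eigenvector_constant:
  fixes R :: "('x::finite \<times> 'x) set"
  assumes "connected_graph R"
    and "\<And>y. (\<Sum>z\<in>UNIV. dist_mat R 1 $ y $ z) = k"
    and "dist_mat R 1 *v v = k *s v"
  shows "v $ a = v $ b"
proof (rule harmonic_constant[OF assms(1)])
  fix y
  have entry: "dist_mat R 1 $ y $ z = (if z \<in> R `` {y} then 1 else 0)" for z
    using gdist_eq_1_iff[OF assms(1), of y z] by (simp add: dist_mat_def)
  have "(\<Sum>z\<in>R `` {y}. v $ z) = (dist_mat R 1 *v v) $ y"
    by (simp add: matrix_vector_mult_def entry if_distrib[of "\<lambda>c. c * _"] sum.If_cases
        del: Image_singleton_iff One_nat_def cong: if_cong)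
  moreover have "(\<Sum>z\<in>R `` {y}. 1) = k"
    using assms(2)[of y] by (simp add: entry sum.If_cases del: Image_singleton_iff One_nat_def)
  ultimately have "(\<Sum>z\<in>R `` {y}. v $ z) = (\<Sum>z\<in>R `` {y}. 1) * v $ y"
    by (simp only: assms(3) vector_smult_component)
  then show "(\<Sum>z\<in>R `` {y}. v $ z - v $ y) = 0"
    by (simp add: sum_subtractf)
qed

lemma valency_eq_card:
  assumes "distance_regular R" "i \<le> gdiam R"
  shows "valency R i = card {z. gdist R x z = i}"
proof -
  have conn: "connected_graph R" using assms by (simp add: distance_regular_def)
  obtain p where p: "\<And>x y. gdist R x y = 0 \<Longrightarrow> card {z. gdist R x z = i \<and> gdist R y z = i} = p"
    using assms unfolding distance_regular_def by blast
  have "intersection_number R 0 i i = p"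
    unfolding intersection_number_def
  proof (rule the_equality)
    fix q
    assume "\<forall>x y. gdist R x y = 0 \<longrightarrow> card {z. gdist R x z = i \<and> gdist R y z = i} = q"
    from this[rule_format, of x x] show "q = p" using p[of x x] by simp
  qed (use p in blast)
  then show ?thesis using p[of x x] by (simp add: valency_def)
qed


section \<open>Semisimplicity of the Terwilliger algebra\<close>

text \<open>
  Invariance needs to be checked only on the generators, since the matrices that preserve a
  subspace form a subalgebra.
\<close>

lemma alg_module_terwilliger_iff:
  "alg_module (terwilliger_algebra R x) U \<longleftrightarrow> vec.subspace U \<and>
    (\<forall>i\<le>gdiam R. \<forall>u\<in>U. dist_mat R i *v u \<in> U \<and> dual_idempotent R x i *v u \<in> U)"
  (is "?L \<longleftrightarrow> ?R")
proof
  assume ?L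
  moreover have "dist_mat R i \<in> terwilliger_algebra R x"
    and "dual_idempotent R x i \<in> terwilliger_algebra R x" if "i \<le> gdiam R" for i
    using that unfolding terwilliger_algebra_def bose_mesner_def
    by (auto intro!: hull_inc mat_space.span_base)
  ultimately show ?R by (auto simp: alg_module_def)
next
  assume R: ?R
  let ?S = "{B. \<forall>u\<in>U. B *v u \<in> U}"
  have sub: "mat_space.subspace ?S" using R by (intro subspace_of_preserving_matrices) auto
  have "mat_subalgebra ?S"
    using sub by (auto simp: mat_subalgebra_def simp flip: matrix_vector_mul_assoc)
  moreover have "bose_mesner R \<subseteq> ?S"
    unfolding bose_mesner_def using R by (intro mat_space.span_minimal sub) auto
  moreover have "dual_idempotent R x ` {..gdiam R} \<subseteq> ?S" using R by auto
  ultimately have "terwilliger_algebra R x \<subseteq> ?S"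
    unfolding terwilliger_algebra_def by (intro hull_minimal) auto
  then show ?L using R by (auto simp: alg_module_def)
qed

text \<open>
  The generators are real symmetric matrices, hence self-adjoint.  The real inner product on
  column vectors suffices here, because a complex subspace has the same orthogonal complement
  for it as for the Hermitian one.
\<close>

lemma alg_module_orthogonal_comp:
  assumes "connected_graph R" "alg_module (terwilliger_algebra R x) U"
  shows "alg_module (terwilliger_algebra R x) (orthogonal_comp U)"
proof -
  have U: "vec.subspace U" and inv: "\<And>i u. i \<le> gdiam R \<Longrightarrow> u \<in> U \<Longrightarrow> dist_mat R i *v u \<in> U"
    "\<And>i u. i \<le> gdiam R \<Longrightarrow> u \<in> U \<Longrightarrow> dual_idempotent R x i *v u \<in> U"
    using assms(2) by (auto simp: alg_module_terwilliger_iff)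
  have adj: "u \<bullet> (dist_mat R i *v v) = (dist_mat R i *v u) \<bullet> v"
    "u \<bullet> (dual_idempotent R x i *v v) = (dual_idempotent R x i *v u) \<bullet> v" for i u v
    by (rule inner_real_symmetric[symmetric];
        auto simp: dist_mat_def dual_idempotent_def gdist_commute[OF assms(1)])+
  have "u \<bullet> (c *s v) = 0" if "u \<in> U" "v \<in> orthogonal_comp U" for u v c
  proof -
    have "cnj c *s u \<in> U" using that(1) U by (simp add: vec.subspace_scale)
    then have "(cnj c *s u) \<bullet> v = 0"
      using that(2) by (auto simp: orthogonal_comp_def orthogonal_def)
    then show ?thesis by (simp add: inner_scale_left_complex)
  qed
  then show ?thesis
    using inv unfolding alg_module_terwilliger_iff vec.subspace_def
    by (auto simp: orthogonal_comp_def orthogonal_def inner_add_right adj)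
qed

lemma irreducible_submodule_exists:
  assumes "alg_module (T :: (complex^'x^'x::finite) set) M" "M \<noteq> {0}"
  shows "\<exists>U. irreducible_module T U \<and> U \<subseteq> M"
  using assms
proof (induction "vec.dim M" arbitrary: M rule: less_induct)
  case less
  show ?case
  proof (cases "irreducible_module T M")
    case False
    then obtain M' where M': "alg_module T M'" "M' \<subseteq> M" "M' \<noteq> {0}" "M' \<noteq> M"
      using less.prems by (auto simp: irreducible_module_def)
    have "vec.dim M' < vec.dim M"
      using M' less.prems vec.subspace_dim_equal[of M' M] vec.dim_subset[of M' M]
      by (force simp: alg_module_def)
    then show ?thesis using less.hyps M' by blast
  qed auto
qed

text \<open>
  Every vector is a sum of vectors from irreducible modules: otherwise the orthogonal complement
  of the span of all irreducible modules would be a nonzero module, and it would contain an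
  irreducible module orthogonal to itself.
\<close>

lemma span_irreducible_modules:
  assumes "connected_graph R"
  shows "vec.span (\<Union> {U. irreducible_module (terwilliger_algebra R x) U}) = UNIV"
    (is "vec.span ?G = UNIV")
proof -
  let ?T = "terwilliger_algebra R x" and ?M = "vec.span ?G"
  have "B *v u \<in> ?M" if "B \<in> ?T" "u \<in> ?M" for B u
    using that(2)
  proof (induction rule: vec.span_induct_alt)
    case base
    then show ?case by (simp add: vec.span_zero)
  next
    case (step c g v)
    then obtain U where "irreducible_module ?T U" "g \<in> U" by auto
    then have "B *v g \<in> ?G"
      using that(1) by (auto simp: irreducible_module_def alg_module_def)
    then show ?case
      using step by (simp add: matrix_vector_right_distrib vector_scalar_commute vec.span_add
          vec.span_scale vec.span_base)
  qed
  then have mod: "alg_module ?T ?M" by (simp add: alg_module_def)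
  have "orthogonal_comp ?M = {0}"
  proof (rule ccontr)
    assume "orthogonal_comp ?M \<noteq> {0}"
    then obtain U where U: "irreducible_module ?T U" "U \<subseteq> orthogonal_comp ?M"
      using irreducible_submodule_exists[OF alg_module_orthogonal_comp[OF assms mod]] by blast
    have "U \<subseteq> ?M" using U(1) by (auto intro: vec.span_base)
    then have "u \<bullet> u = 0" if "u \<in> U" for u
      using U(2) that unfolding orthogonal_comp_def orthogonal_def by blast
    then have "U \<subseteq> {0}" by auto
    moreover have "U \<noteq> {0}" "0 \<in> U"
      using U(1) by (auto simp: irreducible_module_def alg_module_def vec.subspace_0)
    ultimately show False by auto
  qed
  moreover have "orthogonal_comp (orthogonal_comp ?M) = ?M"
    by (intro orthogonal_comp_self complex_subspace_imp_subspace vec.subspace_span)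
  ultimately show ?thesis
    by (simp add: orthogonal_comp_def orthogonal_def)
qed

lemma mat_eq_if_eq_on_irreducible_modules:
  assumes "connected_graph R"
    and "\<And>U u. irreducible_module (terwilliger_algebra R x) U \<Longrightarrow> u \<in> U \<Longrightarrow> B *v u = C *v u"
  shows "B = C"
proof -
  have "B *v v = C *v v" for v
  proof -
    have "v \<in> vec.span (\<Union> {U. irreducible_module (terwilliger_algebra R x) U})"
      by (simp add: span_irreducible_modules[OF assms(1)])
    then show ?thesis
    proof (induction rule: vec.span_induct_alt)
      case (step c g v)
      then show ?case
        using assms(2) by (auto simp: matrix_vector_right_distrib vector_scalar_commute)
    qed auto
  qed
  then show ?thesis by (simp add: matrix_eq)
qed


section \<open>Boltzmann pairs of matrices\<close>

text \<open>
  The defining relation \<open>W A\<^sup>* W\<^sup>-\<^sup>1 = (W\<^sup>*)\<^sup>-\<^sup>1 A W\<^sup>*\<close> of a Boltzmann pair, with its inverses cleared.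
  The inverses are those of maps on the single module \<open>U\<close>, whereas this form, an equation between
  matrix products, extends linearly to sums of modules.
\<close>

lemma boltzmann_pair_intertwines:
  assumes "leonard_pair U (action_on U A) (action_on U A')"
    and "boltzmann_pair U (action_on U A) (action_on U A') (action_on U W) (action_on U W')"
    and "u \<in> U"
  shows "(A ** W' ** W) *v u = (W' ** W ** A') *v u"
proof -
  have "bij_betw (action_on U W) U U" "bij_betw (action_on U W') U U"
    using assms(2) by (auto simp: boltzmann_pair_def)
  note bij = this
  have W: "W *v v \<in> U" "W' *v v \<in> U" if "v \<in> U" for v
    using bij[THEN bij_betwE] that by (auto simp: action_on_def)
  have A: "A *v v \<in> U" "A' *v v \<in> U" if "v \<in> U" for v
    using assms(1) that by (auto simp: leonard_pair_def End_on_def action_on_def PiE_def Pi_def)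
  have eq: "compose U (action_on U W) (compose U (action_on U A') (inv_into U (action_on U W)))
      = compose U (inv_into U (action_on U W')) (compose U (action_on U A) (action_on U W'))"
    using assms(2) by (simp add: boltzmann_pair_def)
  have inv: "inv_into U (action_on U W) (W *v u) = u"
    using bij_betw_inv_into_left[OF bij(1) assms(3)] assms(3) by (simp add: action_on_def)
  let ?a = "A *v (W' *v (W *v u))"
  have a: "?a \<in> U" using assms(3) W A by blast
  have "W *v (A' *v u) = inv_into U (action_on U W') ?a"
    using fun_cong[OF eq, of "W *v u"] assms(3) W A
    by (simp add: compose_def inv) (simp add: action_on_def)
  then have "action_on U W' (W *v (A' *v u)) = ?a"
    using bij_betw_inv_into_right[OF bij(2) a] by simp
  then show ?thesis
    using assms(3) W A by (simp add: action_on_def flip: matrix_vector_mul_assoc)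
qed

lemma balanced_boltzmann_pair_braid:
  assumes "balanced_boltzmann_pair U A A' (action_on U W) (action_on U W')"
    and "u \<in> U"
  shows "(W ** W' ** W) *v u = (W' ** W ** W') *v u"
proof -
  have "bij_betw (action_on U W) U U" "bij_betw (action_on U W') U U"
    using assms(1) by (auto simp: boltzmann_pair_def balanced_boltzmann_pair_def)
  note bij = this
  have W: "W *v v \<in> U" "W' *v v \<in> U" if "v \<in> U" for v
    using bij[THEN bij_betwE] that by (auto simp: action_on_def)
  have eq: "compose U (action_on U W) (compose U (action_on U W') (action_on U W))
    = compose U (action_on U W') (compose U (action_on U W) (action_on U W'))"
    using assms(1) by (simp add: balanced_boltzmann_pair_def)
  show ?thesis
    using fun_cong[OF eq, of u] assms(2) W
    by (simp add: compose_def action_on_def flip: matrix_vector_mul_assoc)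
qed


section \<open>Eigenmatrices\<close>

lemma primitive_idempotents_mult:
  assumes "primitive_idempotents R E" "i \<le> gdiam R" "j \<le> gdiam R"
  shows "E i ** E j = (if i = j then E i else 0)"
  using assms by (simp only: primitive_idempotents_def)

text \<open>
  The zeroth row of the first eigenmatrix holds the eigenvalues on the constant vectors, because
  all entries of \<open>E 0\<close> are equal.
\<close>

lemma dist_mat_row_sum:
  assumes "primitive_idempotents R E" "first_eigenmatrix R E P" "j \<le> gdiam R"
  shows "(\<Sum>z\<in>UNIV. dist_mat R j $ y $ z) = P 0 j"
proof -
  let ?n = "of_nat CARD('a) :: complex"
  have idem: "E i ** E 0 = (if i = 0 then E 0 else 0)" if "i \<le> gdiam R" for i
    using primitive_idempotents_mult[OF assms(1) that, of 0] by simp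
  have "dist_mat R j ** E 0 = (\<Sum>i\<le>gdiam R. P i j *\<^sub>m (E i ** E 0))"
    using assms(2,3) by (simp add: first_eigenmatrix_def mat_sum_mult_left mat_scale_mult_left)
  also have "\<dots> = (\<Sum>i\<le>gdiam R. if i = 0 then P 0 j *\<^sub>m E 0 else 0)"
    by (intro sum.cong) (auto simp: idem)
  also have "\<dots> = P 0 j *\<^sub>m E 0" by simp
  finally have eq: "(dist_mat R j ** E 0) $ y $ y = P 0 j * E 0 $ y $ y"
    by (simp add: mat_scale_nth)
  have E0: "E 0 $ a $ b = 1 / ?n" for a b
    using assms(1) by (simp add: primitive_idempotents_def mat_scale_nth)
  show ?thesis
    using eq by (simp add: matrix_matrix_mult_def E0 flip: sum_divide_distrib)
qed

lemma dist_mat_combination_nth: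
  "(\<Sum>i\<le>gdiam R. c i *\<^sub>m dist_mat R i) $ x $ y = c (gdist R x y)"
proof -
  have "(\<Sum>i\<le>gdiam R. c i *\<^sub>m dist_mat R i) $ x $ y
      = (\<Sum>i\<le>gdiam R. if i = gdist R x y then c i else 0)"
    unfolding sum_component mat_scale_nth
    by (intro sum.cong) (auto simp: dist_mat_def)
  also have "\<dots> = c (gdist R x y)" by (simp add: gdist_le_gdiam)
  finally show ?thesis .
qed

lemma idempotent_nth:
  assumes "second_eigenmatrix R E Q" "j \<le> gdiam R"
  shows "E j $ (x :: 'x::finite) $ y = Q (gdist R x y) j / of_nat CARD('x)"
  using assms dist_mat_combination_nth[of "\<lambda>i. Q i j" R x y]
  by (simp add: second_eigenmatrix_def mat_scale_nth)

text \<open>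
  Orthogonal idempotents make multiplication coordinatewise, so reciprocal coefficients give
  inverse matrices up to a scalar.
\<close>

lemma idempotent_combination_inverse:
  assumes "primitive_idempotents R E" "\<And>i. i \<le> gdiam R \<Longrightarrow> a i * b i = c"
  shows "(\<Sum>i\<le>gdiam R. a i *\<^sub>m E i) ** (\<Sum>i\<le>gdiam R. b i *\<^sub>m E i) = c *\<^sub>m mat 1"
proof -
  have "(\<Sum>i\<le>gdiam R. a i *\<^sub>m E i) ** (\<Sum>i\<le>gdiam R. b i *\<^sub>m E i)
      = (\<Sum>j\<le>gdiam R. \<Sum>i\<le>gdiam R. if i = j then (a j * b j) *\<^sub>m E j else 0)"
    unfolding mat_sum_mult_left mat_sum_mult_right
    by (intro sum.cong) (auto simp: mat_scale_mult_left mat_scale_mult_right mult.commute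
        primitive_idempotents_mult[OF assms(1)])
  also have "\<dots> = (\<Sum>i\<le>gdiam R. c *\<^sub>m E i)"
    by (auto simp: assms(2) intro!: sum.cong)
  also have "\<dots> = c *\<^sub>m mat 1"
    using assms(1) by (simp add: primitive_idempotents_def flip: mat_space.scale_sum_right)
  finally show ?thesis .
qed

section \<open>The spin model\<close>

theorem theorem13p7:
  fixes R :: "('x::finite \<times> 'x) set"
    and E :: "nat \<Rightarrow> complex^'x^'x"
    and f :: complex
    and \<tau> :: "nat \<Rightarrow> complex"
    and W :: "complex^'x^'x"
    and Wstar :: "'x \<Rightarrow> complex^'x^'x"
    and D :: nat
  assumes "distance_regular R"
    and "D = gdiam R"
    and "D \<ge> 1"
    and "primitive_idempotents R E"
    and "formally_self_dual R E"
    and "f \<noteq> 0"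
    and "\<And>i. i \<le> D \<Longrightarrow> \<tau> i \<noteq> 0"
    and "\<tau> 0 = 1"
    and "W = f *\<^sub>m (\<Sum>i\<le>D. \<tau> i *\<^sub>m E i)"
    and "\<And>x. Wstar x = f *\<^sub>m (\<Sum>i\<le>D. \<tau> i *\<^sub>m dual_idempotent R x i)"
    and "\<And>x U. irreducible_module (terwilliger_algebra R x) U \<Longrightarrow>
      thin R x U \<and>
      endpoint R x U = dual_endpoint R E U \<and>
      (spin_leonard_pair U (action_on U (dist_mat R 1)) (action_on U (dual_dist_mat E x 1)) \<and>
       balanced_boltzmann_pair U (action_on U (dist_mat R 1)) (action_on U (dual_dist_mat E x 1))
         (action_on U W) (action_on U (Wstar x))) \<and>
      f powi (-2) = complex_of_real (real CARD('x) powr (-3/2)) *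
        (\<Sum>i\<le>D. of_nat (valency R i) * \<tau> i)"
  shows "spin_model W"
proof -
  note D = assms(2)
  define n where "n = (of_nat CARD('x) :: complex)"
  define s where "s = complex_of_real (sqrt (real CARD('x)))"
  have n0: "n \<noteq> 0" by (simp add: n_def)
  have s0: "s \<noteq> 0" by (simp add: s_def)
  have conn: "connected_graph R" using assms(1) by (simp add: distance_regular_def)
  obtain P Q where P: "first_eigenmatrix R E P" and Q: "second_eigenmatrix R E Q"
    and PQ: "\<And>i j. i \<le> D \<Longrightarrow> j \<le> D \<Longrightarrow> P i j = Q i j"
    using assms(5) by (auto simp: formally_self_dual_def D)
  note row_sum = dist_mat_row_sum[OF assms(4) P]

  have intertwine: "dist_mat R 1 ** Wstar x ** W = Wstar x ** W ** dual_dist_mat E x 1" for x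
  proof (rule mat_eq_if_eq_on_irreducible_modules[OF conn])
    fix U u
    assume U: "irreducible_module (terwilliger_algebra R x) U" and u: "u \<in> U"
    show "(dist_mat R 1 ** Wstar x ** W) *v u = (Wstar x ** W ** dual_dist_mat E x 1) *v u"
      using assms(11)[OF U] u unfolding spin_leonard_pair_def balanced_boltzmann_pair_def
      by (blast intro: boltzmann_pair_intertwines)
  qed
  have braid: "W ** Wstar x ** W = Wstar x ** W ** Wstar x" for x
  proof (rule mat_eq_if_eq_on_irreducible_modules[OF conn])
    fix U u
    assume U: "irreducible_module (terwilliger_algebra R x) U" and u: "u \<in> U"
    show "(W ** Wstar x ** W) *v u = (Wstar x ** W ** Wstar x) *v u"
      using assms(11)[OF U] u by (blast intro: balanced_boltzmann_pair_braid)
  qed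

  \<comment> \<open>The entry of \<open>W\<close> at distance \<open>i\<close>; self-duality permits \<open>P\<close> in the place of \<open>Q\<close>.\<close>
  define w where "w i = f / n * (\<Sum>j\<le>D. \<tau> j * P i j)" for i
  have W_nth: "W $ x $ y = w (gdist R x y)" for x y
  proof -
    have "W $ x $ y = f * (\<Sum>j\<le>D. \<tau> j * E j $ x $ y)"
      by (simp add: assms(9) mat_scale_nth)
    also have "(\<Sum>j\<le>D. \<tau> j * E j $ x $ y) = (\<Sum>j\<le>D. \<tau> j * (P (gdist R x y) j / n))"
      using gdist_le_gdiam[of R x y]
      by (auto simp: idempotent_nth[OF Q] PQ D n_def intro!: sum.cong)
    finally show ?thesis by (simp add: w_def sum_distrib_left mult.commute)
  qed
  have Wstar_nth: "Wstar x $ y $ z = (if y = z then f * \<tau> (gdist R x y) else 0)" for x y z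
  proof -
    have "Wstar x $ y $ z
        = f * (\<Sum>i\<le>D. if i = gdist R x y then (if y = z then \<tau> i else 0) else 0)"
      unfolding assms(10) sum_component mat_scale_nth
      by (intro arg_cong[of _ _ "(*) f"] sum.cong) (auto simp: dual_idempotent_def)
    also have "\<dots> = (if y = z then f * \<tau> (gdist R x y) else 0)"
      using gdist_le_gdiam[of R x y] by (simp add: D)
    finally show ?thesis .
  qed

  \<comment> \<open>The zeroth row of \<open>P\<close> consists of the valencies, so the entry of \<open>W\<close> at distance zero is
    \<open>f / n\<close> times the sum in the normalisation of \<open>f\<close>.\<close>
  have w0: "f * w 0 = s"
  proof -
    \<comment> \<open>The normalisation of \<open>f\<close> is part of the hypothesis on irreducible modules; some irreducible
      module exists because the whole space is a nonzero module.\<close>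
    obtain U where "irreducible_module (terwilliger_algebra R undefined) U"
      using irreducible_submodule_exists[of "terwilliger_algebra R undefined" UNIV]
      by (auto simp: alg_module_def)
    then have iv: "f powi (-2) = complex_of_real (real CARD('x) powr (-3/2)) *
        (\<Sum>i\<le>D. of_nat (valency R i) * \<tau> i)"
      using assms(11) by blast
    have k: "P 0 j = of_nat (valency R j)" if "j \<le> D" for j
      using that row_sum[of j undefined] valency_eq_card[OF assms(1), of j undefined]
      by (simp add: D dist_mat_def sum.If_cases)
    define S where "S = (\<Sum>j\<le>D. \<tau> j * P 0 j)"
    define c where "c = complex_of_real (real CARD('x) powr (-3/2))"
    have "S = (\<Sum>j\<le>D. of_nat (valency R j) * \<tau> j)"
      unfolding S_def by (intro sum.cong) (simp_all add: k)
    then have "f powi (-2) = c * S" using iv by (simp add: c_def)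
    moreover have "f * f * f powi (-2) = 1"
      using assms(6) by (simp add: power_int_minus power2_eq_square field_simps)
    ultimately have fcS: "f * f * (c * S) = 1" by simp
    have "real CARD('x) powr (1/2) * real CARD('x) powr 1 * real CARD('x) powr (-3/2) = 1"
      by (simp only: powr_add[symmetric]) simp
    then have "complex_of_real (sqrt (real CARD('x)) * real CARD('x) * real CARD('x) powr (-3/2)) = 1"
      by (simp add: powr_half_sqrt)
    then have snc: "s * n * c = 1" by (simp only: s_def n_def c_def of_real_mult of_real_of_nat_eq)
    have "f * f * S = f * f * S * (s * n * c)" by (simp only: snc mult_1_right)
    also have "\<dots> = s * n * (f * f * (c * S))" by (simp only: mult_ac)
    also have "\<dots> = s * n" by (simp only: fcS mult_1_right)
    finally show ?thesis using n0 by (simp add: w_def S_def field_simps)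
  qed

  have entries: "f * \<tau> (gdist R x y) * w (gdist R x y) = s" for x y
  proof -
    \<comment> \<open>The image of the unit vector at \<open>x\<close> is an eigenvector of the adjacency matrix for the
      valency, hence constant; its coordinate at \<open>x\<close> itself is known from the distance-zero
      entry.\<close>
    define v where "v = Wstar x *v (W *v axis x 1)"
    have v_nth: "v $ y = f * \<tau> (gdist R x y) * w (gdist R x y)" for y
    proof -
      have "v $ y = f * \<tau> (gdist R x y) * W $ y $ x"
        by (simp add: v_def matrix_vector_mult_axis matrix_vector_mult_def[of "Wstar x"]
            Wstar_nth if_distrib[of "\<lambda>c. c * _"] cong: if_cong)
      then show ?thesis by (simp add: W_nth gdist_commute[OF conn, of y x])
    qed
    \<comment> \<open>The eigenvalue is \<open>Q 0 1\<close>, which equals the valency \<open>P 0 1\<close> by self-duality.\<close>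
    have "dual_dist_mat E x 1 *v axis x 1 = P 0 1 *s axis x 1"
      unfolding vec_eq_iff matrix_vector_mult_axis vector_smult_component
      using assms(3) PQ[of 0 1]
      by (auto simp: dual_dist_mat_def axis_def idempotent_nth[OF Q] D)
    moreover have "dist_mat R 1 *v v = (Wstar x ** W ** dual_dist_mat E x 1) *v axis x 1"
      unfolding v_def intertwine[symmetric] by (simp add: matrix_vector_mul_assoc matrix_mul_assoc)
    ultimately have "dist_mat R 1 *v v = P 0 1 *s v"
      by (simp add: v_def vector_scalar_commute flip: matrix_vector_mul_assoc)
    then have "v $ y = v $ x"
      using trivial_eigenvector_constant[OF conn row_sum] assms(3) by (simp add: D)
    then show ?thesis using w0 assms(8) by (simp add: v_nth)
  qed
  \<comment> \<open>As every distance up to the diameter occurs, the formula for entries holds for all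
    coefficients.\<close>
  have coeff: "f * \<tau> i * w i = s" if "i \<le> D" for i
    using gdist_attained[OF conn, of i] that entries by (auto simp: D)
  have w_nonzero: "w (gdist R x y) \<noteq> 0" for x y
    using entries[of x y] s0 by auto

  have sym: "W $ a $ b = W $ b $ a" for a b
    by (simp add: W_nth gdist_commute[OF conn, of a b])
  have inverse_entries: "(\<Sum>y\<in>UNIV. W $ a $ y / W $ b $ y) = (if a = b then n else 0)" for a b
  proof -
    \<comment> \<open>\<open>N\<close> is a multiple of the entrywise inverse of \<open>W\<close>.  Its coefficients in the idempotent
      basis are again the sums that define \<open>w\<close>, which makes it a multiple of the matrix inverse.\<close>
    define N where "N = (\<Sum>i\<le>D. \<tau> i *\<^sub>m dist_mat R i)"
    have N_nth: "1 / W $ y $ b = f / s * N $ y $ b" for y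
      unfolding N_def D dist_mat_combination_nth W_nth
      using entries[of y b] w_nonzero[of y b] s0 by (simp add: field_simps)
    have "N = (\<Sum>j\<le>D. \<Sum>i\<le>D. (\<tau> j * P i j) *\<^sub>m E i)"
      using P by (simp add: N_def first_eigenmatrix_def D mat_space.scale_sum_right)
    also have "\<dots> = (\<Sum>i\<le>D. (\<Sum>j\<le>D. \<tau> j * P i j) *\<^sub>m E i)"
      by (subst sum.swap) (simp add: mat_space.scale_sum_left)
    also have "\<dots> = (\<Sum>i\<le>D. (n / f * w i) *\<^sub>m E i)"
      using n0 assms(6) by (simp add: w_def)
    finally have N_eigen: "N = (\<Sum>i\<le>D. (n / f * w i) *\<^sub>m E i)" .
    have "W ** N = f *\<^sub>m ((\<Sum>i\<le>D. \<tau> i *\<^sub>m E i) ** (\<Sum>i\<le>D. (n / f * w i) *\<^sub>m E i))"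
      by (simp add: assms(9) N_eigen mat_scale_mult_left)
    also have "\<dots> = f *\<^sub>m ((n * s / (f * f)) *\<^sub>m mat 1)"
      unfolding D
      by (subst idempotent_combination_inverse[OF assms(4), where c = "n * s / (f * f)"])
        (use coeff assms(6) in \<open>auto simp: D field_simps\<close>)
    finally have "(W ** N) $ a $ b = (if a = b then n * s / f else 0)"
      using assms(6) by (simp add: mat_scale_nth mat_def)
    moreover have "(\<Sum>y\<in>UNIV. W $ a $ y / W $ b $ y) = f / s * (W ** N) $ a $ b"
    proof -
      have "W $ a $ y / W $ b $ y = f / s * (W $ a $ y * N $ y $ b)" for y
        using N_nth[of y] by (simp add: sym[of b] divide_inverse)
      then show ?thesis by (simp add: matrix_matrix_mult_def sum_distrib_left)
    qed
    ultimately show ?thesis using s0 assms(6) by simp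
  qed
  have "(\<Sum>y\<in>UNIV. W $ a $ y * W $ b $ y / W $ c $ y) = s * (W $ a $ b / (W $ a $ c * W $ b $ c))"
    for a b c
  proof -
    have star: "f * \<tau> (gdist R c y) = s / W $ c $ y" for y
      using entries[of c y] w_nonzero[of c y] by (simp add: W_nth field_simps)
    have right: "(B ** Wstar c) $ p $ q = B $ p $ q * (s / W $ c $ q)" for B p q
      by (simp add: matrix_matrix_mult_def Wstar_nth star if_distrib[of "\<lambda>d. _ * d"] cong: if_cong)
    have left: "(Wstar c ** B) $ p $ q = s / W $ c $ p * B $ p $ q" for B p q
      by (simp add: matrix_matrix_mult_def Wstar_nth star if_distrib[of "\<lambda>d. d * _"] cong: if_cong)
    have "(W ** Wstar c ** W) $ a $ b = s * (\<Sum>y\<in>UNIV. W $ a $ y * W $ b $ y / W $ c $ y)"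
      unfolding matrix_matrix_mult_def[of "W ** Wstar c"]
      by (simp add: right sym[of b] sum_distrib_left mult_ac)
    moreover have "(Wstar c ** W ** Wstar c) $ a $ b = s / W $ c $ a * W $ a $ b * (s / W $ c $ b)"
      by (simp add: left right)
    ultimately have "s * (\<Sum>y\<in>UNIV. W $ a $ y * W $ b $ y / W $ c $ y)
        = s * (s * (W $ a $ b / (W $ a $ c * W $ b $ c)))"
      by (simp add: braid sym[of c] mult_ac)
    then show ?thesis by (rule mult_left_cancel[OF s0, THEN iffD1])
  qed
  then show ?thesis
    using inverse_entries sym W_nth w_nonzero
    by (auto simp: spin_model_def type_II_def transpose_def vec_eq_iff n_def s_def)
qed

end
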